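(* Let $\gamma\in(1,5/3]$, $A\in C^2(\mathbf R_+)$ with $A>0$, and $a=A'/A$. Let $\bar a\in C^1_b(\mathbf R_+)\cap L^1(\mathbf R_+)$ and positive constants $L_1,L_2,U_1,U_2$ satisfy $|a(x)|<l\,\bar a(x)$ for all $x\ge0$ and $$U_1e^{2\int_0^\infty\bar a(x)dx}\le L_1,\quad L_2\le U_2,\quad \frac{3-\gamma}{\gamma+1}<\frac{L_2}{L_1},\quad \frac{U_2}{U_1}<\frac{\gamma+1}{3-\gamma},$$ $$\frac{L_1}{L_2}\le\sigma_1,\quad \frac{U_2}{U_1}\le\sigma_1,\quad U_2\ge L_1,\quad U_1\ge L_2 .$$ If $(z_0(x),w_0(x))\in\Delta_{m,x}$ for every $x\ge0$ and (P1) has a smooth solution $(z,w)$ satisfying $\rho\ge0$, then $\Delta_{m,x}$ is an invariant region for (P1): $(z(x,t),w(x,t))\in\Delta_{m,x}$ for every $x\ge0$ and every $t\geq 0$ in the time interval of existence of the solution.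
   Context: Notation: $\mathbf R_+=[0,\infty)$; $C^1_b$ denotes $C^1$ functions that are bounded together with their first derivative. $\theta=(\gamma-1)/2$. The problem comes from the isentropic nozzle flow equations $\rho_t+m_x=-a(x)m$, $m_t+(m^2/\rho+p(\rho))_x=-a(x)m^2/\rho$, $p(\rho)=\rho^\gamma/\gamma$, $v=m/\rho$, via the Riemann invariants $w=v+\rho^\theta/\theta$, $z=v-\rho^\theta/\theta$, so that $v=(w+z)/2$ and $\rho=(\theta(w-z)/2)^{1/\theta}$; thus $\rho\ge0$ means $w\ge z$. The characteristic speeds are $\lambda_1=v-\rho^\theta=\frac{\gamma+1}{4}z+\frac{3-\gamma}{4}w$ and $\lambda_2=v+\rho^\theta=\frac{3-\gamma}{4}z+\frac{\gamma+1}{4}w$. Problem (P1): on $x\ge0$, $t\ge0$, $$z_t+\lambda_1z_x=\tfrac{\gamma-1}{8}a(x)(w^2-z^2),\qquad w_t+\lambda_2w_x=-\tfrac{\gamma-1}{8}a(x)(w^2-z^2),$$ with initial data $(z,w)|_{t=0}=(z_0,w_0)$ and boundary condition $v|_{x=0}=0$, i.e. $(w+z)|_{x=0}=0$. Solutions are considered in the class of bounded $C^1$ functions on $\mathbf R_+\times[0,T]$. Constants $l,\sigma_1$: let $f(r)=\frac{2}{\gamma-1}\,\frac{\gamma+1+(3-\gamma)r}{|r^2-1|}$ (with $f(\pm1)=+\infty$). $l>0$ is the minimum of $f$ on $[-1,1]$; $-\sigma_1$ (with $\sigma_1>1$) is the solution of $f(r)=l$ in $r<-1$. Region: $$\Delta_{m,x}=\Big\{(z,w):-L_1e^{-\int_0^x\bar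 a(y)dy}\le z\le-U_1e^{\int_0^x\bar a(y)dy},\ L_2e^{-\int_0^x\bar a(y)dy}\le w\le U_2e^{\int_0^x\bar a(y)dy},\ w\ge z\Big\}.$$ *)

theory Defs
  imports "HOL-Analysis.Analysis"
begin

definition has_C1_deriv :: "(real \<Rightarrow> real) \<Rightarrow> (real \<Rightarrow> real) \<Rightarrow> bool" where
  "has_C1_deriv f f' \<longleftrightarrow>
     (\<forall>x\<ge>0. (f has_real_derivative f' x) (at x within {0..})) \<and> continuous_on {0..} f'"

definition C2_halfline :: "(real \<Rightarrow> real) \<Rightarrow> (real \<Rightarrow> real) \<Rightarrow> bool" where
  "C2_halfline f f' \<longleftrightarrow> has_C1_deriv f f' \<and> (\<exists>f''. has_C1_deriv f' f'')"

definition C1b_halfline :: "(real \<Rightarrow> real) \<Rightarrow> bool" where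
  "C1b_halfline f \<longleftrightarrow>
     (\<exists>f'. has_C1_deriv f f' \<and> bounded (f ` {0..}) \<and> bounded (f' ` {0..}))"

definition has_C1_partials ::
    "real \<Rightarrow> (real \<Rightarrow> real \<Rightarrow> real) \<Rightarrow> (real \<Rightarrow> real \<Rightarrow> real) \<Rightarrow> (real \<Rightarrow> real \<Rightarrow> real) \<Rightarrow> bool" where
  \<comment> \<open>\<open>u x t\<close> is \<open>C\<^sup>1\<close> on \<open>[0,\<infinity>) \<times> [0,T]\<close> up to the boundary, with partial derivatives
      \<open>ux\<close> in \<open>x\<close> and \<open>ut\<close> in \<open>t\<close>\<close>
  "has_C1_partials T u ux ut \<longleftrightarrow>
     (\<forall>x\<ge>0. \<forall>t\<in>{0..T}.
        ((\<lambda>y. u y t) has_real_derivative ux x t) (at x within {0..}) \<and>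
        ((\<lambda>s. u x s) has_real_derivative ut x t) (at t within {0..T})) \<and>
     continuous_on ({0..} \<times> {0..T}) (\<lambda>(x, t). ux x t) \<and>
     continuous_on ({0..} \<times> {0..T}) (\<lambda>(x, t). ut x t)"

definition velocity :: "real \<Rightarrow> real \<Rightarrow> real" where
  "velocity z w = (w + z) / 2"

definition lambda1 :: "real \<Rightarrow> real \<Rightarrow> real \<Rightarrow> real" where
  "lambda1 \<gamma> z w = (\<gamma> + 1) / 4 * z + (3 - \<gamma>) / 4 * w"

definition lambda2 :: "real \<Rightarrow> real \<Rightarrow> real \<Rightarrow> real" where
  "lambda2 \<gamma> z w = (3 - \<gamma>) / 4 * z + (\<gamma> + 1) / 4 * w"

definition P1_solution ::
    "real \<Rightarrow> (real \<Rightarrow> real) \<Rightarrow> (real \<Rightarrow> real) \<Rightarrow> (real \<Rightarrow> real) \<Rightarrow> real \<Rightarrow>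
     (real \<Rightarrow> real \<Rightarrow> real) \<Rightarrow> (real \<Rightarrow> real \<Rightarrow> real) \<Rightarrow> bool" where
  "P1_solution \<gamma> a z0 w0 T z w \<longleftrightarrow>
     bounded ((\<lambda>(x, t). z x t) ` ({0..} \<times> {0..T})) \<and>
     bounded ((\<lambda>(x, t). w x t) ` ({0..} \<times> {0..T})) \<and>
     (\<exists>zx zt wx wt.
        has_C1_partials T z zx zt \<and> has_C1_partials T w wx wt \<and>
        (\<forall>x\<ge>0. \<forall>t\<in>{0..T}.
           zt x t + lambda1 \<gamma> (z x t) (w x t) * zx x t
             = (\<gamma> - 1) / 8 * a x * ((w x t)\<^sup>2 - (z x t)\<^sup>2) \<and>
           wt x t + lambda2 \<gamma> (z x t) (w x t) * wx x t
             = - ((\<gamma> - 1) / 8 * a x * ((w x t)\<^sup>2 - (z x t)\<^sup>2)))) \<and>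
     (\<forall>x\<ge>0. z x 0 = z0 x \<and> w x 0 = w0 x) \<and>
     (\<forall>t\<in>{0..T}. velocity (z 0 t) (w 0 t) = 0)"

definition ratio_fun :: "real \<Rightarrow> real \<Rightarrow> ereal" where
  "ratio_fun \<gamma> r =
     (if r = 1 \<or> r = -1 then \<infinity>
      else ereal (2 / (\<gamma> - 1) * ((\<gamma> + 1 + (3 - \<gamma>) * r) / \<bar>r\<^sup>2 - 1\<bar>)))"

definition is_minimum_on :: "('a \<Rightarrow> ereal) \<Rightarrow> 'a set \<Rightarrow> real \<Rightarrow> bool" where
  "is_minimum_on f S m \<longleftrightarrow> (\<exists>r\<in>S. f r = ereal m) \<and> (\<forall>r\<in>S. ereal m \<le> f r)"

definition Delta_region ::
    "(real \<Rightarrow> real) \<Rightarrow> real \<Rightarrow> real \<Rightarrow> real \<Rightarrow> real \<Rightarrow> real \<Rightarrow> (real \<times> real) set" where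
  "Delta_region abar L1 L2 U1 U2 x =
     \<comment> \<open>\<open>w \<ge> z\<close> encodes \<open>\<rho> \<ge> 0\<close>: the formula \<open>\<rho> = (\<theta> * (w - z) / 2) powr (1 / \<theta>)\<close> is nonnegative
         for all \<open>z\<close>, \<open>w\<close>, so it would not express this condition\<close>
     {(z, w).
        - L1 * exp (- integral {0..x} abar) \<le> z \<and> z \<le> - U1 * exp (integral {0..x} abar) \<and>
        L2 * exp (- integral {0..x} abar) \<le> w \<and> w \<le> U2 * exp (integral {0..x} abar) \<and>
        w \<ge> z}"

end

theory Submission
  imports Defs
begin

text \<open>
  Put \<open>B x = \<integral>\<^sub>0\<^sup>x abar\<close>. The four bounds defining \<open>\<Delta>\<close> say that \<open>\<tau> exp (\<tau> B) u + C \<ge> 0\<close> for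
  \<open>u \<in> {z, w}\<close> and \<open>\<tau> = \<plusminus>1\<close>. Along the characteristics with speed \<open>\<lambda>\<close> of \<open>u\<close> the left-hand side grows at
  rate \<open>exp (\<tau> B) (\<tau> S + abar \<lambda> u)\<close>, where \<open>S\<close> is the source term. On \<open>\<Delta>\<close> the ratio of the two
  Riemann invariants lies in \<open>[-\<sigma>1, 1]\<close>, where \<open>ratio_fun \<ge> l\<close>; together with \<open>\<bar>a\<bar> < l abar\<close> this
  gives \<open>\<bar>S\<bar> < abar \<lambda> u\<close>, so the rate is positive on all of \<open>\<Delta>\<close>, and near \<open>\<Delta>\<close> by compactness.

  By finite speed of propagation it is enough to work on a compact trapezoid. At the first time some
  bound fails by \<open>\<epsilon>\<close>, the backward characteristic direction stays in the trapezoid, which contradicts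
  the positive rate: at \<open>x = 0\<close> one has \<open>\<lambda>\<^sub>1 < 0\<close>, and there the boundary condition \<open>w = - z\<close> turns
  bounds on \<open>w\<close> into bounds on \<open>z\<close>.
\<close>

section \<open>One-sided calculus on the half-line and the closed half-strip\<close>

lemma has_C1_partials_has_derivative:
  assumes u: "has_C1_partials T u ux ut" and x: "x \<ge> 0" and t: "t \<in> {0..T}"
  shows "((\<lambda>(x, t). u x t) has_derivative (\<lambda>(h, k). ux x t * h + ut x t * k))
           (at (x, t) within {0..} \<times> {0..T})"
proof -
  \<comment> \<open>\<open>has_derivative_partialsI\<close> takes the second partial derivative as a
    bounded linear map, so the number \<open>ut x t\<close> is wrapped by
    \<open>blinfun_scaleR_left\<close>. Derivatives within \<open>{0..}\<close> and
    \<open>{0..T}\<close> make the result valid at boundary points too.\<close>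
  have cont: "continuous_on ({0..} \<times> {0..T}) (\<lambda>p. blinfun_scaleR_left (case p of (x, t) \<Rightarrow> ut x t))"
    using u unfolding has_C1_partials_def
    by (intro bounded_linear.continuous_on[OF bounded_linear_blinfun_scaleR_left]) auto
  have "((\<lambda>(x, t). u x t) has_derivative
          (\<lambda>(h, k). ux x t * h + blinfun_apply (blinfun_scaleR_left (ut x t)) k))
          (at (x, t) within {0..} \<times> {0..T})"
  proof (rule has_derivative_partialsI[where fy = "\<lambda>x t. blinfun_scaleR_left (ut x t)"])
    show "((\<lambda>x. u x t) has_derivative (*) (ux x t)) (at x within {0..})"
      using u x t by (auto simp: has_C1_partials_def has_field_derivative_def)
    show "((\<lambda>s. u y s) has_derivative blinfun_apply (blinfun_scaleR_left (ut y s))) (at s within {0..T})"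
      if "y \<in> {0..}" "s \<in> {0..T}" for y s
      using u that by (auto simp: has_C1_partials_def has_field_derivative_def mult.commute[of _ "ut y s"])
    show "continuous (at (x, t) within {0..} \<times> {0..T}) (\<lambda>(x, t). blinfun_scaleR_left (ut x t))"
      using cont x t by (auto simp: continuous_on_eq_continuous_within case_prod_unfold)
  qed (use t in auto)
  then show ?thesis
    by (simp add: mult.commute[of _ "ut x t"])
qed

lemma has_C1_partials_continuous_on:
  assumes "has_C1_partials T u ux ut"
  shows "continuous_on ({0..} \<times> {0..T}) (\<lambda>(x, t). u x t)"
  using has_C1_partials_has_derivative[OF assms]
  by (force simp: continuous_on_eq_continuous_within intro: has_derivative_continuous)

text \<open>Chain rule along the backward ray through \<open>(x, t)\<close>. With \<open>v\<close>
  the characteristic speed, the differential equation turns the bracket into the source term;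
  working within \<open>S\<close> lets the ray start on the boundary.\<close>

lemma has_C1_partials_line_derivative:
  assumes u: "has_C1_partials T u ux ut" and x: "x \<ge> 0" and t: "t \<in> {0..T}"
    and line: "\<And>s. s \<in> S \<Longrightarrow> x - v * s \<ge> 0 \<and> t - s \<in> {0..T}"
  shows "((\<lambda>s. u (x - v * s) (t - s)) has_real_derivative - (ut x t + v * ux x t)) (at 0 within S)"
proof -
  have "((\<lambda>s. (x - v * s, t - s)) has_derivative (\<lambda>s. (- v * s, - s))) (at 0 within S)"
    by (auto intro!: derivative_eq_intros)
  moreover have "((\<lambda>(x, t). u x t) has_derivative (\<lambda>(h, k). ux x t * h + ut x t * k))
      (at (x - v * 0, t - 0) within (\<lambda>s. (x - v * s, t - s)) ` S)"
    by (rule has_derivative_subset[of _ _ _ "{0..} \<times> {0..T}"])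
      (use has_C1_partials_has_derivative[OF u x t] line in auto)
  ultimately have "((\<lambda>s. (\<lambda>(x, t). u x t) (x - v * s, t - s)) has_derivative
      (\<lambda>s. (\<lambda>(h, k). ux x t * h + ut x t * k) (- v * s, - s))) (at 0 within S)"
    by (rule has_derivative_in_compose)
  then show ?thesis
    by (auto simp: has_field_derivative_def algebra_simps elim!: has_derivative_eq_rhs)
qed

lemma integral_has_real_derivative_halfline:
  fixes f :: "real \<Rightarrow> real"
  assumes "continuous_on {a..} f" "a \<le> x"
  shows "((\<lambda>x. integral {a..x} f) has_real_derivative f x) (at x within {a..})"
proof -
  have "((\<lambda>x. integral {a..x} f) has_real_derivative f x) (at x within {a..x+1})"
    by (rule integral_has_real_derivative)
      (use assms in \<open>auto intro: continuous_on_subset[of "{a..}"]\<close>)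
  moreover have "at x within {a..x+1} = at x within {a..}"
    by (rule at_within_nhd[of _ "{..<x+1}"]) auto
  ultimately show ?thesis by simp
qed

section \<open>Comparison at the first time a bound fails\<close>

lemma compact_sublevel:
  fixes f :: "'a::t2_space \<Rightarrow> real"
  assumes "compact K" "continuous_on K f"
  shows "compact {q \<in> K. f q \<le> c}"
proof -
  have "closed (K \<inter> f -` {..c})"
    using assms by (intro continuous_closed_preimage) (auto intro: compact_imp_closed)
  then have "compact (K \<inter> (K \<inter> f -` {..c}))"
    using assms by (intro compact_Int_closed)
  moreover have "K \<inter> (K \<inter> f -` {..c}) = {q \<in> K. f q \<le> c}" by auto
  ultimately show ?thesis by simp
qed

text \<open>Strict positivity of \<open>D\<close> where all bounds hold persists, by compactness,
  where they fail only slightly. At the first failure by \<epsilon>, moving backward would then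
  lower some \<open>\<phi> k\<close> further, at a time when no bound has failed yet. The freedom to
  pass from \<open>i\<close> to \<open>k\<close> in \<open>backward\<close> serves boundary points,
  where only some directions stay in \<open>K\<close>.\<close>

lemma nonneg_by_backward_derivative:
  fixes \<phi> D :: "'i \<Rightarrow> real \<times> real \<Rightarrow> real"
  assumes K: "compact K" and I: "finite I"
    and cont: "\<And>i. i \<in> I \<Longrightarrow> continuous_on K (\<phi> i)"
    and contD: "\<And>i. i \<in> I \<Longrightarrow> continuous_on K (D i)"
    and time: "\<And>x t s. (x, t) \<in> K \<Longrightarrow> 0 \<le> t \<and> (0 \<le> s \<longrightarrow> s \<le> t \<longrightarrow> (x, s) \<in> K)"
    and init: "\<And>i x. i \<in> I \<Longrightarrow> (x, 0) \<in> K \<Longrightarrow> \<phi> i (x, 0) \<ge> 0"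
    and pos: "\<And>i p. i \<in> I \<Longrightarrow> p \<in> K \<Longrightarrow> (\<And>j. j \<in> I \<Longrightarrow> \<phi> j p \<ge> 0) \<Longrightarrow> D i p > 0"
    and eta: "\<eta> > 0"
    and backward: "\<And>\<epsilon> i x t. 0 < \<epsilon> \<Longrightarrow> \<epsilon> < \<eta> \<Longrightarrow> i \<in> I \<Longrightarrow> (x, t) \<in> K \<Longrightarrow> 0 < t \<Longrightarrow>
        \<phi> i (x, t) = - \<epsilon> \<Longrightarrow> (\<And>j. j \<in> I \<Longrightarrow> \<phi> j (x, t) \<ge> - \<epsilon>) \<Longrightarrow>
        \<exists>k\<in>I. \<phi> k (x, t) = - \<epsilon> \<and> (\<exists>v \<delta>. \<delta> > 0 \<and> (\<forall>s\<in>{0..\<delta>}. (x - v * s, t - s) \<in> K) \<and>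
          ((\<lambda>s. \<phi> k (x - v * s, t - s)) has_real_derivative - D k (x, t)) (at 0 within {0..\<delta>}))"
    and i: "i \<in> I" and p: "p \<in> K"
  shows "\<phi> i p \<ge> 0"
proof (rule ccontr)
  assume neg: "\<not> \<phi> i p \<ge> 0"
  \<comment> \<open>\<open>h\<close> is the total violation; it vanishes exactly where all bounds
    hold.\<close>
  define h where "h q = (\<Sum>j\<in>I. max 0 (- \<phi> j q))" for q
  have conth: "continuous_on K h"
    unfolding h_def by (intro continuous_intros cont)
  \<comment> \<open>On the compact set where \<open>D j \<le> 0\<close> the function
    \<open>h\<close> is positive, since \<open>h q = 0\<close> would bring \<open>pos\<close> into
    force; its minimum there is the threshold. If the set is empty, any positive number
    does.\<close>
  have "\<exists>c>0. \<forall>q\<in>K. D j q \<le> 0 \<longrightarrow> c \<le> h q" if j: "j \<in> I" for j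
  proof (cases "{q \<in> K. D j q \<le> 0} = {}")
    case True
    then show ?thesis by (intro exI[of _ 1]) auto
  next
    case False
    have cpt: "compact {q \<in> K. D j q \<le> 0}"
      by (rule compact_sublevel[OF K contD[OF j]])
    have "continuous_on {q \<in> K. D j q \<le> 0} h"
      by (rule continuous_on_subset[OF conth]) auto
    from continuous_attains_inf[OF cpt False this]
    obtain q where q: "q \<in> K" "D j q \<le> 0" "\<And>r. r \<in> K \<Longrightarrow> D j r \<le> 0 \<Longrightarrow> h q \<le> h r"
      by blast
    have "h q > 0"
    proof (rule ccontr)
      assume "\<not> h q > 0"
      moreover have "h q \<ge> 0" unfolding h_def by (intro sum_nonneg) auto
      ultimately have "h q = 0" by simp
      then have "\<And>k. k \<in> I \<Longrightarrow> max 0 (- \<phi> k q) = 0"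
        unfolding h_def by (subst (asm) sum_nonneg_eq_0_iff) (use I in auto)
      then have "\<And>k. k \<in> I \<Longrightarrow> \<phi> k q \<ge> 0" by (smt (verit))
      with pos[OF j q(1)] q(2) show False by force
    qed
    with q(3) show ?thesis by blast
  qed
  then obtain c where c: "\<And>j. j \<in> I \<Longrightarrow> c j > 0"
      "\<And>j q. j \<in> I \<Longrightarrow> q \<in> K \<Longrightarrow> D j q \<le> 0 \<Longrightarrow> c j \<le> h q"
    by metis
  define m where "m = Min (c ` I)"
  have "m \<in> c ` I" unfolding m_def using I i by (intro Min_in) auto
  then have m: "m > 0" "\<And>j. j \<in> I \<Longrightarrow> m \<le> c j"
    using I c(1) by (auto simp: m_def)
  \<comment> \<open>The three terms ensure that the failure at \<open>p\<close> reaches \<epsilon>,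
    that \<open>backward\<close> applies, and that \<open>card I\<close> violations of size
    \<epsilon> stay below the threshold \<open>m\<close>.\<close>
  define \<epsilon> where "\<epsilon> = min (- \<phi> i p) (min (\<eta> / 2) (m / (2 * card I)))"
  have cI: "card I > 0" using I i card_gt_0_iff by blast
  have eps: "0 < \<epsilon>" "\<epsilon> < \<eta>" "\<phi> i p \<le> - \<epsilon>"
    unfolding \<epsilon>_def using neg eta m cI by auto
  have "\<epsilon> \<le> m / (2 * card I)" by (simp add: \<epsilon>_def)
  then have "card I * \<epsilon> \<le> m / 2"
    using cI by (simp add: field_simps)
  then have cardeps: "card I * \<epsilon> < m" using m by simp
  \<comment> \<open>A point of least time in this compact set is a first failure by
    \<epsilon>.\<close>
  define V where "V = (\<Union>j\<in>I. {q \<in> K. \<phi> j q \<le> - \<epsilon>})"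
  have "compact V"
    unfolding V_def using I K cont by (intro compact_UN compact_sublevel) auto
  moreover have "V \<noteq> {}" unfolding V_def using i p eps by blast
  moreover have "continuous_on V snd" by (intro continuous_intros)
  ultimately obtain q where q: "q \<in> V" "\<And>r. r \<in> V \<Longrightarrow> snd q \<le> snd r"
    using continuous_attains_inf[of V snd] by blast
  obtain x t where xt: "q = (x, t)" by (cases q)
  obtain j where j: "j \<in> I" "(x, t) \<in> K" "\<phi> j (x, t) \<le> - \<epsilon>"
    using q(1) xt by (auto simp: V_def)
  have before: "\<phi> k r > - \<epsilon>" if "k \<in> I" "r \<in> K" "snd r < t" for k r
  proof (rule ccontr)
    assume "\<not> \<phi> k r > - \<epsilon>"
    then have "\<phi> k r \<le> - \<epsilon>" by simp
    then have "r \<in> V" using that unfolding V_def by blast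
    from q(2)[OF this] that xt show False by simp
  qed
  have t0: "t > 0"
    using time[OF j(2), of 0] init[OF j(1), of x] j eps by (cases "t = 0") auto
  \<comment> \<open>A value below \<open>- \<epsilon>\<close> at \<open>(x, t)\<close> would, by the
    intermediate value theorem on the vertical segment down to time 0, force the value
    \<open>- \<epsilon>\<close> at an earlier time.\<close>
  have all: "\<phi> k (x, t) \<ge> - \<epsilon>" if k: "k \<in> I" for k
  proof (rule ccontr)
    assume less: "\<not> \<phi> k (x, t) \<ge> - \<epsilon>"
    have "continuous_on {0..t} (\<lambda>s. \<phi> k (x, s))"
      by (rule continuous_on_compose2[OF cont[OF k], of _ "\<lambda>s. (x, s)"])
        (use time[OF j(2)] in \<open>auto intro!: continuous_intros\<close>)
    moreover have "\<phi> k (x, 0) \<ge> - \<epsilon>"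
      using init[OF k, of x] time[OF j(2), of 0] t0 eps by auto
    ultimately obtain s where "0 \<le> s" "s \<le> t" "\<phi> k (x, s) = - \<epsilon>"
      using IVT2'[of "\<lambda>s. \<phi> k (x, s)" t "- \<epsilon>" 0] less t0 by auto
    with less before[OF k, of "(x, s)"] time[OF j(2), of s] show False
      by (cases "s = t") auto
  qed
  have "\<phi> j (x, t) = - \<epsilon>" using all[OF j(1)] j(3) by simp
  from backward[OF eps(1,2) j(1,2) t0 this all]
  obtain k v \<delta> where k: "k \<in> I" "\<phi> k (x, t) = - \<epsilon>" and \<delta>: "\<delta> > 0"
      "\<And>s. s \<in> {0..\<delta>} \<Longrightarrow> (x - v * s, t - s) \<in> K"
    and der: "((\<lambda>s. \<phi> k (x - v * s, t - s)) has_real_derivative - D k (x, t)) (at 0 within {0..\<delta>})"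
    by blast
  have "h (x, t) \<le> (\<Sum>j\<in>I. \<epsilon>)"
    unfolding h_def using all eps by (intro sum_mono) (force simp: max_def)
  also have "\<dots> < m" using cardeps by simp
  finally have "\<not> D k (x, t) \<le> 0"
    using c(2)[OF k(1) j(2)] m(2)[OF k(1)] by auto
  then have "- D k (x, t) < 0" by simp
  from has_real_derivative_neg_dec_right[OF der this]
  obtain d where d: "d > 0" "\<And>h. h > 0 \<Longrightarrow> h \<in> {0..\<delta>} \<Longrightarrow> h < d \<Longrightarrow>
      \<phi> k (x - v * h, t - h) < \<phi> k (x, t)"
    by auto
  define s where "s = min \<delta> (d / 2)"
  have s: "s > 0" "s \<in> {0..\<delta>}" "s < d" using \<delta>(1) d(1) by (auto simp: s_def)
  from d(2)[OF s] before[OF k(1) \<delta>(2)[OF s(2)]] k(2) s(1) show False by simp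
qed


section \<open>The source term against the transport term\<close>

text \<open>For \<open>r < -1\<close> the numerator increases with \<open>r\<close> while
  \<open>\<bar>r\<^sup>2 - 1\<bar>\<close> decreases, so the value \<open>l\<close> at
  \<open>- \<sigma>1\<close> is a lower bound up to \<open>-1\<close>; on \<open>[-1, 1]\<close> it
  is the minimum. Clearing denominators includes \<open>r = 1\<close> and \<open>r = -1\<close>,
  where \<open>ratio_fun\<close> is infinite.\<close>

lemma ratio_fun_lower_bound:
  assumes gamma: "1 < \<gamma>" "\<gamma> \<le> 5 / 3"
    and l: "l > 0" "is_minimum_on (ratio_fun \<gamma>) {-1..1} l"
    and sigma1: "\<sigma>1 > 1" "ratio_fun \<gamma> (- \<sigma>1) = ereal l"
    and r: "- \<sigma>1 \<le> r" "r \<le> 1"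
  shows "\<gamma> + 1 + (3 - \<gamma>) * r > 0"
    and "l * (\<gamma> - 1) / 2 * \<bar>r\<^sup>2 - 1\<bar> \<le> \<gamma> + 1 + (3 - \<gamma>) * r"
proof -
  define n where "n r = \<gamma> + 1 + (3 - \<gamma>) * r" for r
  have n_mono: "n p \<le> n q" if "p \<le> q" for p q
    unfolding n_def using gamma that by (simp add: mult_left_mono)
  have n1: "n (- 1) > 0" using gamma by (simp add: n_def)
  have sq: "\<sigma>1\<^sup>2 > 1" using sigma1 by (simp add: power2_eq_square less_1_mult)
  have "l = 2 / (\<gamma> - 1) * (n (- \<sigma>1) / (\<sigma>1\<^sup>2 - 1))"
    using sigma1 sq by (auto simp: ratio_fun_def n_def)
  then have ns: "n (- \<sigma>1) = l * (\<gamma> - 1) / 2 * (\<sigma>1\<^sup>2 - 1)"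
    using gamma sq by (simp add: divide_simps)
  have "n (- \<sigma>1) > 0" unfolding ns using gamma l sq by simp
  then show "\<gamma> + 1 + (3 - \<gamma>) * r > 0"
    using n_mono[OF r(1)] by (simp add: n_def)
  then have npos: "n r > 0" by (simp add: n_def)
  have "l * (\<gamma> - 1) / 2 * \<bar>r\<^sup>2 - 1\<bar> \<le> n r"
  proof -
    consider "r = 1 \<or> r = - 1" | "- 1 < r" "r < 1" | "r < - 1" using r by linarith
    then show ?thesis
    proof cases
      case 1
      then show ?thesis using npos by auto
    next
      case 2
      then have "r\<^sup>2 < 1" by (simp add: abs_square_less_1 abs_less_iff)
      moreover have "ereal l \<le> ratio_fun \<gamma> r"
        using l 2 by (auto simp: is_minimum_on_def)
      then have "l \<le> 2 / (\<gamma> - 1) * (n r / \<bar>r\<^sup>2 - 1\<bar>)"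
        using 2 by (auto simp: ratio_fun_def n_def)
      ultimately show ?thesis using gamma by (simp add: pos_le_divide_eq mult_ac)
    next
      case 3
      have "(- r)\<^sup>2 \<le> \<sigma>1\<^sup>2" using 3 r by (intro power_mono) auto
      moreover have "r\<^sup>2 > 1" using 3 by (smt (verit) one_power2 power2_minus power_strict_mono zero_less_numeral)
      ultimately have "l * (\<gamma> - 1) / 2 * \<bar>r\<^sup>2 - 1\<bar> \<le> l * (\<gamma> - 1) / 2 * (\<sigma>1\<^sup>2 - 1)"
        using gamma l by (intro mult_left_mono) auto
      then show ?thesis using ns n_mono[OF r(1)] by simp
    qed
  qed
  then show "l * (\<gamma> - 1) / 2 * \<bar>r\<^sup>2 - 1\<bar> \<le> \<gamma> + 1 + (3 - \<gamma>) * r"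
    by (simp add: n_def)
qed

text \<open>Division by \<open>u\<^sup>2 / 4\<close> leaves an inequality in the ratio
  \<open>v / u\<close> alone, which is the preceding bound. The form is used with \<open>u\<close>
  as either Riemann invariant and \<open>v\<close> as the other.\<close>

lemma source_bound:
  assumes gamma: "1 < \<gamma>" "\<gamma> \<le> 5 / 3"
    and l: "l > 0" "is_minimum_on (ratio_fun \<gamma>) {-1..1} l"
    and sigma1: "\<sigma>1 > 1" "ratio_fun \<gamma> (- \<sigma>1) = ereal l"
    and ab: "\<bar>\<alpha>\<bar> < l * \<beta>"
    and u: "u \<noteq> 0" and r: "- \<sigma>1 \<le> v / u" "v / u \<le> 1"
  shows "\<bar>(\<gamma> - 1) / 8 * \<alpha> * (v\<^sup>2 - u\<^sup>2)\<bar> < \<beta> * (u * ((\<gamma> + 1) / 4 * u + (3 - \<gamma>) / 4 * v))"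
proof -
  define r where "r = v / u"
  define n where "n = \<gamma> + 1 + (3 - \<gamma>) * r"
  have v: "v = r * u" using u by (simp add: r_def)
  have beta: "\<beta> > 0" using ab l by (smt (verit) zero_less_mult_pos)
  have rb: "n > 0" "l * (\<gamma> - 1) / 2 * \<bar>r\<^sup>2 - 1\<bar> \<le> n"
    using ratio_fun_lower_bound[OF gamma l sigma1 r] by (simp_all add: n_def r_def)
  have "(\<gamma> - 1) / 2 * \<bar>\<alpha>\<bar> * \<bar>r\<^sup>2 - 1\<bar> < \<beta> * n"
  \<comment> \<open>If \<open>r\<^sup>2 = 1\<close>, strictness comes from \<open>n > 0\<close>;
    otherwise it comes from \<open>ab\<close>.\<close>
  proof (cases "r\<^sup>2 = 1")
    case True
    then show ?thesis using rb beta by simp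
  next
    case False
    then have "(\<gamma> - 1) / 2 * \<bar>r\<^sup>2 - 1\<bar> * \<bar>\<alpha>\<bar> < (\<gamma> - 1) / 2 * \<bar>r\<^sup>2 - 1\<bar> * (l * \<beta>)"
      using gamma ab by (intro mult_strict_left_mono) auto
    also have "\<dots> = \<beta> * (l * (\<gamma> - 1) / 2 * \<bar>r\<^sup>2 - 1\<bar>)" by simp
    also have "\<dots> \<le> \<beta> * n" using rb beta by (intro mult_left_mono) auto
    finally show ?thesis by (simp add: mult_ac)
  qed
  then have *: "u\<^sup>2 / 4 * ((\<gamma> - 1) / 2 * \<bar>\<alpha>\<bar> * \<bar>r\<^sup>2 - 1\<bar>) < u\<^sup>2 / 4 * (\<beta> * n)"
    using u by (intro mult_strict_left_mono) auto
  have "(\<gamma> - 1) / 8 * \<alpha> * (v\<^sup>2 - u\<^sup>2) = u\<^sup>2 / 4 * ((\<gamma> - 1) / 2 * \<alpha> * (r\<^sup>2 - 1))"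
    by (simp add: v power2_eq_square field_simps)
  then have "\<bar>(\<gamma> - 1) / 8 * \<alpha> * (v\<^sup>2 - u\<^sup>2)\<bar> = u\<^sup>2 / 4 * ((\<gamma> - 1) / 2 * \<bar>\<alpha>\<bar> * \<bar>r\<^sup>2 - 1\<bar>)"
    using gamma by (simp only: abs_mult) simp
  moreover have "\<beta> * (u * ((\<gamma> + 1) / 4 * u + (3 - \<gamma>) / 4 * v)) = u\<^sup>2 / 4 * (\<beta> * n)"
    by (simp add: v n_def power2_eq_square field_simps)
  ultimately show ?thesis using * by (simp only:)
qed

section \<open>Domains of dependence\<close>

text \<open>The slanted side recedes with speed \<Lambda>, so backward rays of speed at most
  \<Lambda> cannot cross it.\<close>

definition trapezoid :: "real \<Rightarrow> real \<Rightarrow> real \<Rightarrow> (real \<times> real) set" where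
  "trapezoid \<Lambda> R T = {(x, t). 0 \<le> x \<and> 0 \<le> t \<and> t \<le> T \<and> x + \<Lambda> * t \<le> R}"

lemma compact_trapezoid:
  assumes "\<Lambda> \<ge> 0"
  shows "compact (trapezoid \<Lambda> R T)"
proof -
  have "compact {p \<in> {0..R} \<times> {0..T}. fst p + \<Lambda> * snd p \<le> R}"
    by (intro compact_sublevel compact_Times continuous_intros) auto
  moreover have "trapezoid \<Lambda> R T = {p \<in> {0..R} \<times> {0..T}. fst p + \<Lambda> * snd p \<le> R}"
    using mult_nonneg_nonneg[OF assms] by (force simp: trapezoid_def)
  ultimately show ?thesis by simp
qed

lemma trapezoid_backward:
  assumes "(x, t) \<in> trapezoid \<Lambda> R T" "t > 0" "\<bar>v\<bar> \<le> \<Lambda>" "x = 0 \<Longrightarrow> v \<le> 0"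
  shows "\<exists>\<delta>>0. \<forall>s\<in>{0..\<delta>}. (x - v * s, t - s) \<in> trapezoid \<Lambda> R T"
proof -
  \<comment> \<open>The bound \<open>t\<close> keeps time nonnegative, and
    \<open>x / (\<Lambda> + 1)\<close> keeps the ray in \<open>x \<ge> 0\<close>; the added 1 avoids
    division by zero for \<open>\<Lambda> = 0\<close>.\<close>
  define \<delta> where "\<delta> = (if x = 0 then t else min t (x / (\<Lambda> + 1)))"
  have x: "x \<ge> 0" and t: "t \<le> T" and xt: "x + \<Lambda> * t \<le> R"
    using assms(1) by (auto simp: trapezoid_def)
  have "\<delta> > 0" using assms x by (auto simp: \<delta>_def)
  moreover have "(x - v * s, t - s) \<in> trapezoid \<Lambda> R T" if s: "s \<in> {0..\<delta>}" for s
  proof -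
    have "s \<le> t" using s by (auto simp: \<delta>_def split: if_splits)
    moreover have "x - v * s \<ge> 0"
    proof (cases "x = 0")
      case True
      then show ?thesis using assms(4) s by (simp add: mult_nonpos_nonneg)
    next
      case False
      then have "s \<le> x / (\<Lambda> + 1)" using s by (auto simp: \<delta>_def)
      then have "(\<Lambda> + 1) * s \<le> x" using assms(3) by (simp add: field_simps)
      moreover have "v * s \<le> (\<Lambda> + 1) * s" using assms(3) s by (intro mult_right_mono) auto
      ultimately show ?thesis by simp
    qed
    moreover have "- v * s \<le> \<Lambda> * s" using assms(3) s by (intro mult_right_mono) auto
    ultimately show ?thesis using s t xt by (auto simp: trapezoid_def algebra_simps)
  qed
  ultimately show ?thesis by blast
qed

section \<open>Invariance of the region\<close>

theorem proposition2p1: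
  fixes \<gamma> l \<sigma>1 L1 L2 U1 U2 T :: real
    and A A' a abar z0 w0 :: "real \<Rightarrow> real"
    and z w :: "real \<Rightarrow> real \<Rightarrow> real"
  assumes gamma: "1 < \<gamma>" "\<gamma> \<le> 5 / 3"
    and l: "l > 0" "is_minimum_on (ratio_fun \<gamma>) {-1..1} l"
    and sigma1: "\<sigma>1 > 1" "ratio_fun \<gamma> (- \<sigma>1) = ereal l"
    and A: "C2_halfline A A'" "\<forall>x\<ge>0. A x > 0"
    and a: "\<forall>x\<ge>0. a x = A' x / A x"
    and abar: "C1b_halfline abar" "abar absolutely_integrable_on {0..}"
    and pos: "L1 > 0" "L2 > 0" "U1 > 0" "U2 > 0"
    and a_abar: "\<forall>x\<ge>0. \<bar>a x\<bar> < l * abar x"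
    and bounds: "U1 * exp (2 * integral {0..} abar) \<le> L1" "L2 \<le> U2"
      "(3 - \<gamma>) / (\<gamma> + 1) < L2 / L1" "U2 / U1 < (\<gamma> + 1) / (3 - \<gamma>)"
      "L1 / L2 \<le> \<sigma>1" "U2 / U1 \<le> \<sigma>1" "U2 \<ge> L1" "U1 \<ge> L2"
    and init: "\<forall>x\<ge>0. (z0 x, w0 x) \<in> Delta_region abar L1 L2 U1 U2 x"
    and T: "T > 0"
    and sol: "P1_solution \<gamma> a z0 w0 T z w"
    and rho_nonneg: "\<forall>x\<ge>0. \<forall>t\<in>{0..T}. w x t \<ge> z x t"
  shows "\<forall>x\<ge>0. \<forall>t\<in>{0..T}. (z x t, w x t) \<in> Delta_region abar L1 L2 U1 U2 x"
proof -
  obtain zx zt wx wt where zC1: "has_C1_partials T z zx zt" and wC1: "has_C1_partials T w wx wt"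
    and zeq: "\<And>x t. x \<ge> 0 \<Longrightarrow> t \<in> {0..T} \<Longrightarrow> zt x t + lambda1 \<gamma> (z x t) (w x t) * zx x t
             = (\<gamma> - 1) / 8 * a x * ((w x t)\<^sup>2 - (z x t)\<^sup>2)"
    and weq: "\<And>x t. x \<ge> 0 \<Longrightarrow> t \<in> {0..T} \<Longrightarrow> wt x t + lambda2 \<gamma> (z x t) (w x t) * wx x t
             = - ((\<gamma> - 1) / 8 * a x * ((w x t)\<^sup>2 - (z x t)\<^sup>2))"
    using sol unfolding P1_solution_def by blast
  have ic: "\<And>x. x \<ge> 0 \<Longrightarrow> z x 0 = z0 x \<and> w x 0 = w0 x"
    and bc: "\<And>t. t \<in> {0..T} \<Longrightarrow> z 0 t = - w 0 t"
    and bdd: "bounded ((\<lambda>(x, t). z x t) ` ({0..} \<times> {0..T}))"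
      "bounded ((\<lambda>(x, t). w x t) ` ({0..} \<times> {0..T}))"
    using sol unfolding P1_solution_def velocity_def by (auto simp: eq_neg_iff_add_eq_0 add.commute)
  define B where "B x = integral {0..x} abar" for x
  \<comment> \<open>\<open>k\<close> selects the family: \<open>True\<close> for \<open>w\<close>
    with \<open>lambda2\<close>, \<open>False\<close> for \<open>z\<close> with
    \<open>lambda1\<close>. The sign \<tau> is 1 for a lower bound and -1 for an upper
    bound.\<close>
  define u where "u k = (if k then w else z)" for k
  define lam where "lam k x t = (if k then lambda2 else lambda1) \<gamma> (z x t) (w x t)" for k x t
  define src where "src k x t = (if k then - 1 else 1) *
      ((\<gamma> - 1) / 8 * a x * ((w x t)\<^sup>2 - (z x t)\<^sup>2))" for k x t
  define C where "C k \<tau> = (if k then (if \<tau> = 1 then - L2 else U2) else (if \<tau> = 1 then L1 else - U1))"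
    for k and \<tau> :: real
  define \<phi> where "\<phi> = (\<lambda>(k, \<tau>) (x, t). \<tau> * (exp (\<tau> * B x) * u k x t) + C k \<tau>)"
  \<comment> \<open>This is the derivative of \<phi> along the forward characteristic: the source
    acts on \<open>u\<close>, and the weight contributes \<open>\<tau> * abar * lam\<close>.\<close>
  define D where "D = (\<lambda>(k, \<tau>) (x, t). \<tau> * (exp (\<tau> * B x) *
      (src k x t + \<tau> * (abar x * (lam k x t * u k x t)))))"
  define I where "I = (UNIV :: bool set) \<times> {1, - 1 :: real}"

  have region: "(z x t, w x t) \<in> Delta_region abar L1 L2 U1 U2 x \<longleftrightarrow>
      (\<forall>i\<in>I. \<phi> i (x, t) \<ge> 0) \<and> z x t \<le> w x t" for x t
  proof -
    have "\<phi> (False, 1) (x, t) \<ge> 0 \<longleftrightarrow> - L1 * exp (- B x) \<le> z x t"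
      "\<phi> (False, - 1) (x, t) \<ge> 0 \<longleftrightarrow> z x t \<le> - U1 * exp (B x)"
      "\<phi> (True, 1) (x, t) \<ge> 0 \<longleftrightarrow> L2 * exp (- B x) \<le> w x t"
      "\<phi> (True, - 1) (x, t) \<ge> 0 \<longleftrightarrow> w x t \<le> U2 * exp (B x)"
      by (simp_all add: \<phi>_def u_def C_def exp_minus field_simps) linarith
    moreover have "I = {(False, 1), (False, - 1), (True, 1), (True, - 1)}"
      by (auto simp: I_def)
    ultimately show ?thesis
      by (simp add: Delta_region_def flip: B_def)
  qed

  have abar_cont: "continuous_on {0..} abar"
    using abar(1) by (auto simp: C1b_halfline_def has_C1_deriv_def intro: DERIV_continuous_on)
  have "continuous_on {0..} A" "continuous_on {0..} A'"
    using A(1) by (auto simp: C2_halfline_def has_C1_deriv_def intro: DERIV_continuous_on)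
  then have "continuous_on {0..} (\<lambda>x. A' x / A x)"
    using A(2) by (intro continuous_intros) (auto simp: less_imp_neq[symmetric])
  then have a_cont: "continuous_on {0..} a"
    using a by (subst continuous_on_cong[OF refl]) auto
  have B_deriv: "(B has_real_derivative abar x) (at x within {0..})" if "x \<ge> 0" for x
    unfolding B_def using integral_has_real_derivative_halfline[OF abar_cont that] .
  then have B_cont: "continuous_on {0..} B"
    by (auto intro!: DERIV_continuous_on)
  have uC1: "has_C1_partials T (u k) (if k then wx else zx) (if k then wt else zt)" for k
    using zC1 wC1 by (simp add: u_def)
  have ueq: "(if k then wt else zt) x t + lam k x t * (if k then wx else zx) x t = src k x t"
    if "x \<ge> 0" "t \<in> {0..T}" for k x t
    using zeq[OF that] weq[OF that] by (simp add: lam_def src_def)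

  obtain M where M: "\<And>x t. x \<ge> 0 \<Longrightarrow> t \<in> {0..T} \<Longrightarrow> \<bar>z x t\<bar> \<le> M \<and> \<bar>w x t\<bar> \<le> M"
  proof -
    obtain Mz where "\<And>x t. x \<ge> 0 \<Longrightarrow> t \<in> {0..T} \<Longrightarrow> \<bar>z x t\<bar> \<le> Mz"
      using bdd(1) unfolding bounded_iff by force
    moreover obtain Mw where "\<And>x t. x \<ge> 0 \<Longrightarrow> t \<in> {0..T} \<Longrightarrow> \<bar>w x t\<bar> \<le> Mw"
      using bdd(2) unfolding bounded_iff by force
    ultimately show ?thesis using that[of "max Mz Mw"] by (force simp: le_max_iff_disj)
  qed
  \<comment> \<open>Both speeds are convex combinations of \<open>z\<close> and \<open>w\<close>, so
    the bound on the solution also bounds the speeds.\<close>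
  have lam_le: "\<bar>lam k x t\<bar> \<le> M" if "x \<ge> 0" "t \<in> {0..T}" for k x t
  proof -
    have conv: "\<bar>c * p + d * q\<bar> \<le> M" if "\<bar>p\<bar> \<le> M" "\<bar>q\<bar> \<le> M" "c \<ge> 0" "d \<ge> 0" "c + d = 1" for c d p q
    proof -
      have "\<bar>c * p + d * q\<bar> \<le> c * \<bar>p\<bar> + d * \<bar>q\<bar>"
        using that abs_triangle_ineq[of "c * p" "d * q"] by (simp add: abs_mult)
      also have "\<dots> \<le> c * M + d * M" using that by (intro add_mono mult_left_mono) auto
      also have "\<dots> = M" using that by (simp flip: distrib_right)
      finally show ?thesis .
    qed
    have "(3 - \<gamma>) / 4 + (\<gamma> + 1) / 4 = 1" by (simp add: field_simps)
    then show ?thesis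
      using M[OF that] gamma conv[of "z x t" "w x t" "(3 - \<gamma>) / 4" "(\<gamma> + 1) / 4"]
        conv[of "z x t" "w x t" "(\<gamma> + 1) / 4" "(3 - \<gamma>) / 4"]
      by (simp add: lam_def lambda1_def lambda2_def add.commute)
  qed
  have M0: "M \<ge> 0" using M[of 0 0] T by auto

  show ?thesis
  proof (intro allI ballI impI)
    fix X t' :: real assume X: "X \<ge> 0" and t': "t' \<in> {0..T}"
    \<comment> \<open>The slanted side of this trapezoid passes through the target point
      \<open>(X, t')\<close>.\<close>
    define K where "K = trapezoid M (X + M * t') T"
    have KD: "x \<ge> 0" "t \<in> {0..T}" if "(x, t) \<in> K" for x t
      using that by (auto simp: K_def trapezoid_def)
    have Ksub: "K \<subseteq> {0..} \<times> {0..T}" using KD by auto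
    have u_contK: "continuous_on K (\<lambda>p. u k (fst p) (snd p))" for k
      using continuous_on_subset[OF has_C1_partials_continuous_on[OF uC1] Ksub]
      by (simp add: case_prod_unfold)
    have zw_contK: "continuous_on K (\<lambda>p. z (fst p) (snd p))" "continuous_on K (\<lambda>p. w (fst p) (snd p))"
      using u_contK[of False] u_contK[of True] by (simp_all add: u_def)
    have fst_contK: "continuous_on K (\<lambda>p. f (fst p))" if "continuous_on {0..} f" for f :: "real \<Rightarrow> real"
      by (rule continuous_on_compose2[OF that]) (use Ksub in \<open>auto intro!: continuous_intros\<close>)
    \<comment> \<open>The chosen \<eta> is minus the value of \<open>lambda1\<close> at
      \<open>z = - U1\<close>, \<open>w = U2\<close>. Since its coefficients sum to 1, bounds
      failing by \<epsilon> raise \<open>lambda1\<close> at \<open>x = 0\<close> to at most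
      \<open>\<epsilon> - \<eta>\<close>, still negative.\<close>
    have "\<phi> i (X, t') \<ge> 0" if i: "i \<in> I" for i
    proof (rule nonneg_by_backward_derivative[where K = K and I = I and \<phi> = \<phi> and D = D
          and \<eta> = "((\<gamma> + 1) * U1 - (3 - \<gamma>) * U2) / 4"])
      show "compact K" unfolding K_def using M0 by (rule compact_trapezoid)
      show "finite I" by (simp add: I_def)
      show "continuous_on K (\<phi> i)" if "i \<in> I" for i
        unfolding \<phi>_def case_prod_unfold by (intro continuous_intros u_contK fst_contK B_cont)
      show "continuous_on K (D i)" if "i \<in> I" for i
      proof -
        have "continuous_on K (\<lambda>p. src k (fst p) (snd p))" for k
          unfolding src_def by (intro continuous_intros fst_contK a_cont zw_contK)
        moreover have "continuous_on K (\<lambda>p. lam k (fst p) (snd p))" for k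
          unfolding lam_def lambda1_def lambda2_def
          by (cases k) (auto intro!: continuous_intros zw_contK)
        ultimately show ?thesis
          unfolding D_def case_prod_unfold
          by (intro continuous_intros u_contK fst_contK B_cont abar_cont)
      qed
      show "0 \<le> t \<and> (0 \<le> s \<longrightarrow> s \<le> t \<longrightarrow> (x, s) \<in> K)" if xt: "(x, t) \<in> K" for x t s
      proof -
        have "(x, s) \<in> K" if "0 \<le> s" "s \<le> t"
          using xt that mult_left_mono[OF that(2) M0] by (auto simp: K_def trapezoid_def)
        then show ?thesis using KD(2)[OF xt] by auto
      qed
      show "\<phi> i (x, 0) \<ge> 0" if "i \<in> I" "(x, 0) \<in> K" for i x
        using init ic[OF KD(1)[OF that(2)]] region[of x 0] that KD(1) by auto
      show "D i p > 0" if i: "i \<in> I" and p: "p \<in> K" and all: "\<And>j. j \<in> I \<Longrightarrow> \<phi> j p \<ge> 0" for i p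
      proof -
        obtain k \<tau> x t where i_eq: "i = (k, \<tau>)" and p_eq: "p = (x, t)" by (cases i, cases p)
        have xt: "x \<ge> 0" "t \<in> {0..T}" using KD p p_eq by auto
        have "(z x t, w x t) \<in> Delta_region abar L1 L2 U1 U2 x"
          using region all rho_nonneg xt p_eq by auto
        then have zw: "- L1 * exp (- B x) \<le> z x t" "z x t \<le> - U1 * exp (B x)"
            "L2 * exp (- B x) \<le> w x t" "w x t \<le> U2 * exp (B x)"
          by (auto simp: Delta_region_def B_def)
        have z_neg: "z x t < 0" using zw(2) pos by (smt (verit) exp_gt_zero mult_minus_left mult_pos_pos)
        have w_pos: "w x t > 0" using zw(3) pos by (smt (verit) exp_gt_zero mult_pos_pos)
        \<comment> \<open>Equal exponential weights cancel in the ratios: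
          \<open>w / (- z) \<le> U2 / U1\<close> from the bounds with \<open>exp (B x)\<close>, and
          \<open>- z / w \<le> L1 / L2\<close> from those with \<open>exp (- B x)\<close>. Both are
          at most \<sigma>1.\<close>
        have "U2 * exp (B x) \<le> \<sigma>1 * U1 * exp (B x)"
          using bounds(6) pos by (intro mult_right_mono) (auto simp: field_simps)
        also have "\<dots> \<le> \<sigma>1 * - z x t"
          using mult_left_mono[of "U1 * exp (B x)" "- z x t" \<sigma>1] zw sigma1 by simp
        finally have wz: "w x t \<le> \<sigma>1 * - z x t" using zw(4) by simp
        have "L1 * exp (- B x) \<le> \<sigma>1 * L2 * exp (- B x)"
          using bounds(5) pos by (intro mult_right_mono) (auto simp: field_simps)
        also have "\<dots> \<le> \<sigma>1 * w x t"
          using mult_left_mono[of "L2 * exp (- B x)" "w x t" \<sigma>1] zw sigma1 by simp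
        finally have zw': "- z x t \<le> \<sigma>1 * w x t" using zw(1) by simp
        have ab: "\<bar>a x\<bar> < l * abar x" using a_abar xt by simp
        have "\<bar>src k x t\<bar> < abar x * (lam k x t * u k x t)"
        proof (cases k)
          case True
          have "\<bar>(\<gamma> - 1) / 8 * a x * ((z x t)\<^sup>2 - (w x t)\<^sup>2)\<bar>
              < abar x * (w x t * ((\<gamma> + 1) / 4 * w x t + (3 - \<gamma>) / 4 * z x t))"
            by (rule source_bound[OF gamma l sigma1 ab])
              (use w_pos z_neg zw' in \<open>auto simp: field_simps\<close>)
          moreover have "src k x t = (\<gamma> - 1) / 8 * a x * ((z x t)\<^sup>2 - (w x t)\<^sup>2)"
            using True minus_diff_eq[of "(z x t)\<^sup>2" "(w x t)\<^sup>2"]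
            by (simp add: src_def flip: mult_minus_right)
          moreover have "lam k x t * u k x t = w x t * ((\<gamma> + 1) / 4 * w x t + (3 - \<gamma>) / 4 * z x t)"
            using True by (simp add: lam_def u_def lambda2_def mult.commute add.commute)
          ultimately show ?thesis by (simp only:)
        next
          case False
          have "\<bar>(\<gamma> - 1) / 8 * a x * ((w x t)\<^sup>2 - (z x t)\<^sup>2)\<bar>
              < abar x * (z x t * ((\<gamma> + 1) / 4 * z x t + (3 - \<gamma>) / 4 * w x t))"
            by (rule source_bound[OF gamma l sigma1 ab])
              (use w_pos z_neg wz in \<open>auto simp: field_simps\<close>)
          then show ?thesis
            using False by (simp add: src_def lam_def u_def lambda1_def mult.commute)
        qed
        then have "\<tau> * src k x t + abar x * (lam k x t * u k x t) > 0"
          using i i_eq by (auto simp: I_def)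
        then have "exp (\<tau> * B x) * (\<tau> * src k x t + abar x * (lam k x t * u k x t)) > 0"
          by simp
        moreover have "D i p = exp (\<tau> * B x) * (\<tau> * src k x t + abar x * (lam k x t * u k x t))"
          using i i_eq p_eq by (auto simp: I_def D_def algebra_simps)
        ultimately show ?thesis by simp
      qed
      show "((\<gamma> + 1) * U1 - (3 - \<gamma>) * U2) / 4 > 0"
        using bounds(4) pos gamma by (simp add: field_simps)
      show "\<exists>k\<in>I. \<phi> k (x, t) = - \<epsilon> \<and> (\<exists>v \<delta>. \<delta> > 0 \<and> (\<forall>s\<in>{0..\<delta>}. (x - v * s, t - s) \<in> K) \<and>
          ((\<lambda>s. \<phi> k (x - v * s, t - s)) has_real_derivative - D k (x, t)) (at 0 within {0..\<delta>}))"
        if eps: "0 < \<epsilon>" "\<epsilon> < ((\<gamma> + 1) * U1 - (3 - \<gamma>) * U2) / 4" and i: "i \<in> I"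
          and xtK: "(x, t) \<in> K" and t: "0 < t" and i_eps: "\<phi> i (x, t) = - \<epsilon>"
          and all: "\<And>j. j \<in> I \<Longrightarrow> \<phi> j (x, t) \<ge> - \<epsilon>" for \<epsilon> i x t
      proof -
        have xt: "x \<ge> 0" "t \<in> {0..T}" using KD xtK by auto
        \<comment> \<open>At \<open>x = 0\<close> the backward ray has to enter
          \<open>x \<ge> 0\<close>, so a failing bound on \<open>z\<close>, whose speed is negative
          there, is sought.\<close>
        have "\<exists>k \<tau>. (k, \<tau>) \<in> I \<and> \<phi> (k, \<tau>) (x, t) = - \<epsilon> \<and> (x = 0 \<longrightarrow> \<not> k)"
        proof -
          obtain k \<tau> where i_eq: "i = (k, \<tau>)" by (cases i)
          show ?thesis
          proof (cases "x = 0 \<and> k")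
            case False
            then show ?thesis using i i_eps i_eq by blast
          next
            case True
            \<comment> \<open>\<open>L2 \<le> U1\<close> and \<open>L1 \<le> U2\<close> turn a violated bound on \<open>w\<close> into the opposite one on \<open>z\<close>.\<close>
            have I': "(False, - \<tau>) \<in> I" using i i_eq by (auto simp: I_def)
            have "B 0 = 0" by (simp add: B_def)
            then have "\<phi> (False, - \<tau>) (x, t) \<le> - \<epsilon>"
              using True i i_eps i_eq bc[OF xt(2)] bounds
              by (auto simp: I_def \<phi>_def u_def C_def)
            then show ?thesis using I' all[OF I'] by (intro exI[of _ False] exI[of _ "- \<tau>"]) auto
          qed
        qed
        then obtain k \<tau> where k: "(k, \<tau>) \<in> I" "\<phi> (k, \<tau>) (x, t) = - \<epsilon>" "x = 0 \<Longrightarrow> \<not> k" by blast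
        define v where "v = lam k x t"
        have "v \<le> 0" if "x = 0"
        proof -
          have "B 0 = 0" by (simp add: B_def)
          then have "z x t \<le> - U1 + \<epsilon>" "w x t \<le> U2 + \<epsilon>"
            using all[of "(False, - 1)"] all[of "(True, - 1)"] that
            by (auto simp: I_def \<phi>_def u_def C_def)
          then have "lambda1 \<gamma> (z x t) (w x t) \<le> (\<gamma> + 1) / 4 * (- U1 + \<epsilon>) + (3 - \<gamma>) / 4 * (U2 + \<epsilon>)"
            unfolding lambda1_def using gamma by (intro add_mono mult_left_mono) auto
          also have "\<dots> = \<epsilon> - ((\<gamma> + 1) * U1 - (3 - \<gamma>) * U2) / 4"
            by (simp add: field_simps)
          finally have "lambda1 \<gamma> (z x t) (w x t) \<le> 0" using eps(2) by linarith
          then show ?thesis using that k by (simp add: v_def lam_def)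
        qed
        moreover have "\<bar>v\<bar> \<le> M" unfolding v_def by (rule lam_le[OF xt])
        ultimately obtain \<delta> where \<delta>: "\<delta> > 0" "\<And>s. s \<in> {0..\<delta>} \<Longrightarrow> (x - v * s, t - s) \<in> K"
          using trapezoid_backward[of x t M "X + M * t'" T v] xtK t unfolding K_def by blast
        have line: "x - v * s \<ge> 0 \<and> t - s \<in> {0..T}" if "s \<in> {0..\<delta>}" for s
          using KD[OF \<delta>(2)[OF that]] by blast
        have u_der: "((\<lambda>s. u k (x - v * s) (t - s)) has_real_derivative - src k x t) (at 0 within {0..\<delta>})"
          using has_C1_partials_line_derivative[OF uC1[of k] xt, of "{0..\<delta>}" v] line
          by (simp add: ueq[OF xt] v_def)
        \<comment> \<open>The derivative of \<open>B\<close> is known within \<open>{0..}\<close>,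
          so the chain rule is applied over the image of the ray, which \<open>line\<close> keeps
          there.\<close>
        have B_der: "((\<lambda>s. B (x - v * s)) has_real_derivative abar x * - v) (at 0 within {0..\<delta>})"
        proof -
          have "((\<lambda>s. x - v * s) has_real_derivative - v) (at 0 within {0..\<delta>})"
            by (auto intro!: derivative_eq_intros)
          moreover have "(B has_real_derivative abar x) (at (x - v * 0) within (\<lambda>s. x - v * s) ` {0..\<delta>})"
            by (rule DERIV_subset[of _ _ _ "{0..}"]) (use B_deriv[OF xt(1)] line in auto)
          ultimately show ?thesis by (rule DERIV_image_chain[unfolded o_def, rotated])
        qed
        have "((\<lambda>s. \<tau> * (exp (\<tau> * B (x - v * s)) * u k (x - v * s) (t - s)) + C k \<tau>) has_real_derivative
            - D (k, \<tau>) (x, t)) (at 0 within {0..\<delta>})"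
          by (rule derivative_eq_intros u_der B_der refl)+ (simp add: D_def v_def algebra_simps)
        then show ?thesis
          using k \<delta> by (intro bexI[of _ "(k, \<tau>)"] conjI exI[of _ v] exI[of _ \<delta>]) (auto simp: \<phi>_def)
      qed
      show "(X, t') \<in> K" using X t' by (simp add: K_def trapezoid_def)
    qed (rule i)
    then show "(z X t', w X t') \<in> Delta_region abar L1 L2 U1 U2 X"
      using region rho_nonneg X t' by auto
  qed
qed

end
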